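(* Let $n$ be a nonnegative integer and let $q,a,x,y$ be nonzero complex numbers with $|q|<1$ such that no factor occurring in a denominator below vanishes. For $0\le m\le k\le j\le n$ put $$U_j=\frac{(q^{-3n};q)_{3j}\,(a/y^2;q^3)_j\,q^{3j}}{(q^3;q^3)_j\,(aq^2/y;q^3)_j\,(aq/y;q^3)_j\,(q^{3-9n}/a;q^3)_j},$$ $$V_{j,k}=\frac{(q^{-3j};q^3)_k\,(yq;q^3)_k\,(yq^2;q^3)_k\,(aq/(xy);q^3)_k\,q^{3k}}{(q^3;q^3)_k\,(aq/x;q^3)_k\,(aq^3/y;q^3)_k\,(y^2q^{3-3j}/a;q^3)_k},$$ $$T_{k,m}=\frac{(q^{-3k};q^3)_m\,(xq^2;q^3)_m\,(y;q^3)_m\,(aq^2/x^2;q^3)_m\,q^{3m}}{(q^3;q^3)_m\,(aq^2/x;q^3)_m\,(aq^3/x;q^3)_m\,(xyq^{2-3k}/a;q^3)_m}.$$ Then $$\sum_{j=0}^{n}\sum_{k=0}^{j}\sum_{m=0}^{k} U_j\,V_{j,k}\,T_{k,m} = \frac{(aq;q)_{3n}\,(aq/(xy);q)_{3n}\,(aq^{3n+1};q^3)_n\,(aq^{3n+2};q^3)_n}{(aq/x;q)_{3n}\,(aq/y;q)_{3n}\,(aq^3;q^3)_n\,(aq^{6n};q^3)_n}\sum_{j=0}^{3n}\frac{(a;q^3)_j\,(x;q)_j\,(y;q)_j\,(q^{-3n};q)_j\,q^j}{(q;q)_j\,(a;q)_{2j}\,(xyq^{-3n}/a;q)_j}.$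$
   Context: For complex $A$ and base $p$, $(A;p)_m=\prod_{i=0}^{m-1}(1-Ap^i)$ for integers $m\ge 0$ (so $(A;p)_0=1$). *)

theory Defs
  imports Complex_Main
begin

text \<open>The finite shifted factorial \<open>(A;p)\<^sub>m\<close>, with an arbitrary base \<open>p\<close>.
  It is nonzero iff none of its factors \<open>1 - A p\<^sup>i\<close> (\<open>i < m\<close>) vanishes.\<close>

definition qpoch :: "complex \<Rightarrow> complex \<Rightarrow> nat \<Rightarrow> complex" where
  "qpoch A p m = (\<Prod>i<m. 1 - A * p ^ i)"

text \<open>Exponents that may be negative are integers, whence \<open>powi\<close>: natural subtraction
  would truncate.\<close>

definition U :: "nat \<Rightarrow> complex \<Rightarrow> complex \<Rightarrow> complex \<Rightarrow> nat \<Rightarrow> complex" where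
  "U n q a y j =
     (qpoch (q powi (- 3 * int n)) q (3 * j) * qpoch (a / y ^ 2) (q ^ 3) j * q ^ (3 * j)) /
     (qpoch (q ^ 3) (q ^ 3) j * qpoch (a * q ^ 2 / y) (q ^ 3) j * qpoch (a * q / y) (q ^ 3) j *
      qpoch (q powi (3 - 9 * int n) / a) (q ^ 3) j)"

definition V :: "complex \<Rightarrow> complex \<Rightarrow> complex \<Rightarrow> complex \<Rightarrow> nat \<Rightarrow> nat \<Rightarrow> complex" where
  "V q a x y j k =
     (qpoch (q powi (- 3 * int j)) (q ^ 3) k * qpoch (y * q) (q ^ 3) k *
      qpoch (y * q ^ 2) (q ^ 3) k * qpoch (a * q / (x * y)) (q ^ 3) k * q ^ (3 * k)) /
     (qpoch (q ^ 3) (q ^ 3) k * qpoch (a * q / x) (q ^ 3) k * qpoch (a * q ^ 3 / y) (q ^ 3) k *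
      qpoch (y ^ 2 * q powi (3 - 3 * int j) / a) (q ^ 3) k)"

definition T :: "complex \<Rightarrow> complex \<Rightarrow> complex \<Rightarrow> complex \<Rightarrow> nat \<Rightarrow> nat \<Rightarrow> complex" where
  "T q a x y k m =
     (qpoch (q powi (- 3 * int k)) (q ^ 3) m * qpoch (x * q ^ 2) (q ^ 3) m *
      qpoch y (q ^ 3) m * qpoch (a * q ^ 2 / x ^ 2) (q ^ 3) m * q ^ (3 * m)) /
     (qpoch (q ^ 3) (q ^ 3) m * qpoch (a * q ^ 2 / x) (q ^ 3) m * qpoch (a * q ^ 3 / x) (q ^ 3) m *
      qpoch (x * y * q powi (2 - 3 * int k) / a) (q ^ 3) m)"

end

theory Submission
  imports Defs
begin

text \<open>Both sides are single very-well-poised sums obtained from Bailey's lemma. In base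
  \<open>p = q\<^sup>3\<close>, start from the unit Bailey pair relative to \<open>a\<close> and apply the lemma with the
  parameter pairs \<open>(xq, x)\<close>, \<open>(xq\<^sup>2, y)\<close>, \<open>(yq, yq\<^sup>2)\<close> and finally
  \<open>(q\<^bsup>1-3n\<^esup>, q\<^bsup>2-3n\<^esup>)\<close>: the first application produces the factor
  \<open>(aq\<^sup>2/x\<^sup>2;p)\<^sub>m\<close> and its denominators in \<open>T\<close>, and the remaining three are the sums over
  \<open>m\<close>, \<open>k\<close> and \<open>j\<close>. In base \<open>q\<close>, there is a Bailey pair with
  \<open>\<beta>\<^sub>n = (a;q\<^sup>3)\<^sub>n / ((q;q)\<^sub>n (a;q)\<^bsub>2n\<^esub>)\<close> whose \<open>\<alpha>\<close> is supported on the multiples of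
  three, and one application with \<open>(x, y)\<close> at \<open>N = 3n\<close> gives the right-hand sum. The two resulting
  single sums agree term by term, since \<open>(A;q)\<^bsub>3r\<^esub> = (A;p)\<^sub>r (Aq;p)\<^sub>r (Aq\<^sup>2;p)\<^sub>r\<close>.\<close>

section \<open>Shifted factorials\<close>

text \<open>The sign and power \<open>(-1)\<^sup>r p\<^bsup>r(r-1)/2\<^esup>\<close> as a product.\<close>

definition qsgn :: "complex \<Rightarrow> nat \<Rightarrow> complex" where
  "qsgn p r = (\<Prod>i<r. - (p ^ i))"

lemma qpoch_0 [simp]: "qpoch A p 0 = 1"
  by (simp add: qpoch_def)

lemma qpoch_Suc: "qpoch A p (Suc m) = qpoch A p m * (1 - A * p ^ m)"
  by (simp add: qpoch_def)

lemma qsgn_0 [simp]: "qsgn p 0 = 1"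
  by (simp add: qsgn_def)

lemma qsgn_Suc: "qsgn p (Suc m) = - (qsgn p m * p ^ m)"
  by (simp add: qsgn_def)

lemma qpoch_add: "qpoch A p (m + k) = qpoch A p m * qpoch (A * p ^ m) p k"
  by (induction k) (simp_all add: qpoch_Suc power_add mult_ac)

lemma qpoch_Suc_left: "qpoch A p (Suc m) = (1 - A) * qpoch (A * p) p m"
  using qpoch_add[of A p 1 m] by (simp add: qpoch_Suc)

lemma qpoch_neq0_mono:
  assumes "qpoch A p n \<noteq> 0" "m \<le> n"
  shows "qpoch A p m \<noteq> 0"
  using assms qpoch_add[of A p m "n - m"] by auto

lemma qpoch_neq0_iff: "qpoch A p n \<noteq> 0 \<longleftrightarrow> (\<forall>i<n. A * p ^ i \<noteq> 1)"
  by (auto simp: qpoch_def)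

lemma qpoch_triple:
  "qpoch A q (3 * m) = qpoch A (q ^ 3) m * qpoch (A * q) (q ^ 3) m * qpoch (A * q ^ 2) (q ^ 3) m"
proof (induction m)
  case (Suc m)
  have "3 * Suc m = Suc (Suc (Suc (3 * m)))" by simp
  then show ?case using Suc
    by (simp only: qpoch_Suc)
       (simp add: power_mult power_add power2_eq_square mult_ac flip: power_mult)
qed simp

text \<open>The exponents agree because 3m(3m-1)/2 = 9 m(m-1)/2 + 3m, and the signs because
  (-1)^(3m) is the cube of (-1)^m.\<close>

lemma qsgn_triple: "qsgn q (3 * m) = qsgn (q ^ 3) m ^ 3 * q ^ (3 * m)"
proof (induction m)
  case (Suc m)
  have eq: "3 * Suc m = Suc (Suc (Suc (3 * m)))" "(q ^ 3) ^ m = q ^ (3 * m)"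
    by (simp_all add: power_mult)
  show ?case
    unfolding eq qsgn_Suc Suc power_Suc by algebra
qed simp

lemma qpoch_falling_Suc:
  "qpoch (A * q ^ Suc n) (1 / q) (Suc k) = (1 - A * q ^ Suc n) * qpoch (A * q ^ n) (1 / q) k"
  if "q \<noteq> 0"
  using that by (simp add: qpoch_Suc_left)

text \<open>In base \<open>1 / q\<close> the product runs through the factors of
  \<open>qpoch (A * q) q n\<close> from the last one downwards, so its k factors complement the
  first n - k.\<close>

lemma qpoch_falling:
  assumes "q \<noteq> 0" "k \<le> n"
  shows "qpoch (A * q ^ n) (1 / q) k * qpoch (A * q) q (n - k) = qpoch (A * q) q n"
  using \<open>k \<le> n\<close>
proof (induction k)
  case (Suc k)
  then have "n - k = Suc (n - Suc k)" by simp
  then have "qpoch (A * q) q (n - k) = qpoch (A * q) q (n - Suc k) * (1 - A * q * q ^ (n - Suc k))"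
    by (simp only: qpoch_Suc)
  moreover have "A * q ^ n / q ^ k = A * (q * q ^ (n - Suc k))"
    using Suc.prems assms(1) by (simp add: power_diff)
  ultimately show ?case
    using Suc by (simp add: qpoch_Suc power_one_over mult_ac)
qed simp

lemma qpoch_falling_eq_0:
  assumes "q \<noteq> 0" "n < k"
  shows "qpoch (q ^ n) (1 / q) k = 0"
  using assms by (auto simp: qpoch_def power_one_over)

text \<open>Factor by factor, 1 - q^i/A = -(q^i/A) (1 - A/q^i).\<close>

lemma qpoch_reflect:
  assumes "q \<noteq> 0" "A \<noteq> 0"
  shows "qpoch (1 / A) q k = qsgn q k / A ^ k * qpoch A (1 / q) k"
proof (induction k)
  case (Suc k)
  show ?case using assms
    by (simp add: Suc qpoch_Suc qsgn_Suc power_one_over) (simp add: field_simps)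
qed simp

lemma qpoch_base_neq0:
  assumes "norm q < 1" shows "qpoch q q n \<noteq> 0"
proof -
  have "q * q ^ i \<noteq> 1" for i
  proof
    assume "q * q ^ i = 1"
    then have "norm q ^ Suc i = 1" by (metis norm_one norm_power power_Suc)
    moreover have "norm q ^ Suc i < 1" using assms
      by (metis norm_ge_zero power_Suc2 power_Suc_le_self mult_le_one less_eq_real_def
          order_le_less_trans power_le_one power_Suc)
    ultimately show False by simp
  qed
  then show ?thesis by (simp add: qpoch_neq0_iff)
qed

text \<open>The factors of the hypothesis are 1 - 1/(A p^i) for i < n in reverse order, each
  vanishing exactly when 1 - A p^i does. This turns nonvanishing denominators of terminating sums
  into nonvanishing numerator symbols.\<close>

lemma qpoch_neq0_reverse:
  assumes "p \<noteq> 0" "A \<noteq> 0" "qpoch (p / (A * p ^ n)) p n \<noteq> 0"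
  shows "qpoch A p n \<noteq> 0"
proof -
  have eq: "p / (A * p ^ n) = 1 / (A / p * p ^ n)" using assms by simp
  have "qpoch (p / (A * p ^ n)) p n = qsgn p n / (A / p * p ^ n) ^ n * qpoch (A / p * p ^ n) (1 / p) n"
    unfolding eq using assms by (intro qpoch_reflect) auto
  moreover have "qpoch (A / p * p ^ n) (1 / p) n = qpoch A p n"
    using qpoch_falling[of p n n "A / p"] assms by simp
  ultimately show ?thesis using assms(3) by auto
qed

section \<open>The \<open>q\<close>-Pfaff--Saalschuetz summation\<close>

text \<open>The terminating summation cleared of its denominators in the parameters, so that it holds for
  all \<open>u\<close>, \<open>v\<close>, \<open>c\<close>; it follows by induction on \<open>M\<close> with the telescoping term \<open>G\<close>.\<close>

lemma q_saalschuetz_poly: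
  fixes q u v c :: complex
  assumes q: "q \<noteq> 0" "\<And>n. qpoch q q n \<noteq> 0"
  shows "(\<Sum>i\<le>M. qpoch (q ^ M) (1 / q) i / qpoch q q i * qpoch u q i * qpoch v q i *
            qpoch c q (M - i) * c ^ i * qpoch (c * u * v * q ^ i) q (M - i)) =
         qpoch (c * u) q M * qpoch (c * v) q M"
proof (induction M)
  case (Suc M)
  define t where "t M i = qpoch (q ^ M) (1 / q) i / qpoch q q i * qpoch u q i * qpoch v q i *
            qpoch c q (M - i) * c ^ i * qpoch (c * u * v * q ^ i) q (M - i)" for M i
  define G where "G i = - (q * q ^ M / q ^ i) * ((1 - q ^ i) / (1 - q * q ^ M)) *
            (qpoch (q ^ Suc M) (1 / q) i / qpoch q q i) * qpoch u q i * qpoch v q i *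
            qpoch c q (Suc M - i) * c ^ i * qpoch (c * u * v * q ^ i / q) q (Suc M - i)" for i
  have ne: "1 - q * q ^ i \<noteq> 0" for i
    using q(2)[of "Suc i"] by (simp add: qpoch_Suc)
  have step: "t (Suc M) i - (1 - c * u * q ^ M) * (1 - c * v * q ^ M) * t M i = G (Suc i) - G i"
    if "i \<le> M" for i
  proof -
    \<comment> \<open>With q^i = Q and q^(M-i) = D, all four quantities are polynomial multiples of
      the common factor \<open>K\<close>, and the claim becomes a polynomial identity in q, Q, D, c,
      u, v.\<close>
    define Q where "Q = q ^ i"
    define D where "D = q ^ (M - i)"
    have QM: "q ^ M = Q * D"
      using that by (simp add: Q_def D_def flip: power_add)
    have Q0: "Q \<noteq> 0" "D \<noteq> 0" using q(1) by (simp_all add: Q_def D_def)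
    define W where "W = qpoch u q i * qpoch v q i * qpoch c q (M - i) * c ^ i *
      qpoch (c * u * v * q ^ i) q (M - i) / qpoch q q i"
    define f where "f = qpoch (q ^ M) (1 / q) i"
    define g where "g = qpoch (q ^ Suc M) (1 / q) i"
    have S: "Suc M - i = Suc (M - i)" using that by simp
    have gf: "g * (1 - q * D) = (1 - q * Q * D) * f"
      using qpoch_falling_Suc[of q 1 M i] q(1) QM Q0
      by (simp add: g_def f_def qpoch_Suc power_one_over field_simps flip: Q_def)
    have nD: "1 - q * D \<noteq> 0" using ne[of "M - i"] by (simp add: D_def)
    have nQ: "1 - q * Q \<noteq> 0" using ne[of i] by (simp add: Q_def)
    have nQD: "1 - q * (Q * D) \<noteq> 0" using ne[of M] by (simp add: QM)
    define K where "K = W * g / (1 - q * (Q * D))"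
    have f: "f = g * (1 - q * D) / (1 - q * (Q * D))"
      using gf nQD by (simp add: field_simps)
    have "t (Suc M) i = W * g * (1 - c * D) * (1 - c * u * v * Q * D)"
      unfolding t_def S qpoch_Suc W_def g_def D_def Q_def by (simp add: field_simps)
    then have t1: "t (Suc M) i = K * ((1 - q * Q * D) * (1 - c * D) * (1 - c * u * v * Q * D))"
      using nQD by (simp add: K_def mult_ac)
    have t2: "t M i = K * (1 - q * D)"
      by (simp add: t_def W_def f K_def mult_ac flip: f_def)
    have fSuc: "qpoch (q ^ Suc M) (1 / q) (Suc i) = (1 - q * (Q * D)) * f"
      using qpoch_falling_Suc[of q 1 M i] q(1) QM by (simp add: f_def)
    have g1: "G (Suc i) = K * (- D * (1 - q * D) * (1 - u * Q) * (1 - v * Q) * c)"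
      unfolding G_def diff_Suc_Suc fSuc f using q(1) nQ nQD Q0
      by (simp add: W_def K_def qpoch_Suc QM mult_ac flip: Q_def)
    have "G i = - (q * D * (1 - Q) / (1 - q * (Q * D)) * W * g * (1 - c * D) *
                 (1 - c * u * v * Q / q))"
      unfolding G_def S using q(1) Q0
      by (subst (2) qpoch_Suc_left)
         (simp add: W_def g_def qpoch_Suc QM flip: Q_def D_def)
    also have "\<dots> = K * (- D * (1 - Q) * (1 - c * D) * (q * (1 - c * u * v * Q / q)))"
      by (simp add: K_def mult_ac)
    also have "q * (1 - c * u * v * Q / q) = q - c * u * v * Q"
      using q(1) by (simp add: algebra_simps)
    finally have g2: "G i = K * (- D * (1 - Q) * (1 - c * D) * (q - c * u * v * Q))" .
    have factor: "K * A - B * C * (K * E) = K * F - K * H" if "A - B * C * E = F - H" for A B C E F H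
    proof -
      have "K * A - B * C * (K * E) = K * (A - B * C * E)" by (simp add: algebra_simps)
      then show ?thesis by (simp add: that right_diff_distrib)
    qed
    show ?thesis
      unfolding t1 t2 g1 g2 QM by (rule factor) algebra
  qed
  have "(\<Sum>i\<le>M. t (Suc M) i) - (1 - c * u * q ^ M) * (1 - c * v * q ^ M) * (\<Sum>i\<le>M. t M i) =
        (\<Sum>i\<le>M. G (Suc i) - G i)"
    by (simp add: step sum_distrib_left flip: sum_subtractf)
  also have "\<dots> = G (Suc M) - G 0"
    by (induction M) simp_all
  also have "G 0 = 0" by (simp add: G_def)
  \<comment> \<open>The telescoped sum stops at M; this boundary value supplies the missing top term
    of the sum for \<open>Suc M\<close>.\<close>
  also have "G (Suc M) = - t (Suc M) (Suc M)"
    using q(1) ne[of M] by (simp add: G_def t_def)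
  finally show ?case
    using Suc unfolding t_def[symmetric] by (simp add: qpoch_Suc algebra_simps)
qed simp

text \<open>The polynomial form divided by \<open>qpoch q q M * qpoch (c * u * v) q M\<close>; the
  split and falling products turn the quotients into symbols of index i and M - i.\<close>

lemma q_saalschuetz:
  assumes q: "q \<noteq> 0" "\<And>n. qpoch q q n \<noteq> 0" and uv: "qpoch (c * u * v) q M \<noteq> 0"
  shows "(\<Sum>i\<le>M. qpoch u q i * qpoch v q i * qpoch c q (M - i) * c ^ i /
            (qpoch q q (M - i) * qpoch q q i * qpoch (c * u * v) q i)) =
         qpoch (c * u) q M * qpoch (c * v) q M / (qpoch q q M * qpoch (c * u * v) q M)"
proof -
  have "qpoch u q i * qpoch v q i * qpoch c q (M - i) * c ^ i /
            (qpoch q q (M - i) * qpoch q q i * qpoch (c * u * v) q i) =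
        qpoch (q ^ M) (1 / q) i / qpoch q q i * qpoch u q i * qpoch v q i *
            qpoch c q (M - i) * c ^ i * qpoch (c * u * v * q ^ i) q (M - i) /
            (qpoch q q M * qpoch (c * u * v) q M)" if "i \<le> M" for i
  proof -
    have 1: "qpoch (q ^ M) (1 / q) i * qpoch q q (M - i) = qpoch q q M"
      using qpoch_falling[OF q(1) that, of 1] by simp
    have 2: "qpoch (c * u * v) q M = qpoch (c * u * v) q i * qpoch (c * u * v * q ^ i) q (M - i)"
      using qpoch_add[of "c * u * v" q i "M - i"] that by simp
    have 3: "qpoch (c * u * v) q i \<noteq> 0" "qpoch (c * u * v * q ^ i) q (M - i) \<noteq> 0"
      using uv 2 by auto
    show ?thesis
      unfolding 1[symmetric] 2
      using q(2)[of M] q(2)[of i] q(2)[of "M - i"] 3 1 by (auto simp: divide_simps)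
  qed
  then have "(\<Sum>i\<le>M. qpoch u q i * qpoch v q i * qpoch c q (M - i) * c ^ i /
            (qpoch q q (M - i) * qpoch q q i * qpoch (c * u * v) q i)) =
      (\<Sum>i\<le>M. qpoch (q ^ M) (1 / q) i / qpoch q q i * qpoch u q i * qpoch v q i *
            qpoch c q (M - i) * c ^ i * qpoch (c * u * v * q ^ i) q (M - i)) /
      (qpoch q q M * qpoch (c * u * v) q M)"
    unfolding sum_divide_distrib by (intro sum.cong refl) auto
  then show ?thesis
    by (simp only: q_saalschuetz_poly[OF q])
qed

section \<open>Bailey pairs\<close>

text \<open>With the base inverted, \<open>qpoch (q ^ n) (1 / q) r\<close> is \<open>(q;q)\<^sub>n / (q;q)\<^bsub>n-r\<^esub>\<close> for
  \<open>r \<le> n\<close> and \<open>0\<close> for \<open>r > n\<close>. It thus encodes the usual kernel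
  \<open>1 / ((q;q)\<^bsub>n-r\<^esub> (aq;q)\<^bsub>n+r\<^esub>)\<close> of a Bailey pair without a truncated subtraction.\<close>

definition bailey_pair :: "complex \<Rightarrow> complex \<Rightarrow> nat \<Rightarrow> (nat \<Rightarrow> complex) \<Rightarrow> (nat \<Rightarrow> complex) \<Rightarrow> bool" where
  "bailey_pair a q N \<alpha> \<beta> \<longleftrightarrow>
     (\<forall>n\<le>N. \<beta> n = (\<Sum>r\<le>n. \<alpha> r * qpoch (q ^ n) (1 / q) r / (qpoch q q n * qpoch (a * q) q (n + r))))"

lemma bailey_kernel:
  assumes "q \<noteq> 0" "\<And>n. qpoch q q n \<noteq> 0" "r \<le> n"
  shows "qpoch (q ^ n) (1 / q) r / qpoch q q n = 1 / qpoch q q (n - r)"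
  using qpoch_falling[OF assms(1,3), of 1] assms(2)[of n] assms(2)[of "n - r"]
  by (simp add: divide_simps)

lemma sum_triangle_shift:
  fixes f :: "nat \<Rightarrow> nat \<Rightarrow> complex"
  shows "(\<Sum>j\<le>n. \<Sum>r\<le>j. f j r) = (\<Sum>r\<le>n. \<Sum>i\<le>n - r. f (r + i) r)"
  unfolding sum.Sigma[OF finite_atMost ballI[OF finite_atMost]]
  by (rule sum.reindex_bij_witness[where i = "\<lambda>(r, i). (r + i, r)" and j = "\<lambda>(j, r). (r, j - r)"]) auto

text \<open>The conjugate Bailey pair: the inner sum that remains in Bailey's lemma once the
  summations are exchanged. Splitting off the first r factors of each \<rho> symbol and the first 2r
  of (aq;q) shifts the parameters to \<rho>1 q^r and \<rho>2 q^r and leaves a q-Saalschuetz sum of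
  length n - r.\<close>

lemma bailey_conjugate:
  assumes q: "q \<noteq> 0" "\<And>n. qpoch q q n \<noteq> 0" and \<rho>: "\<rho>1 \<noteq> 0" "\<rho>2 \<noteq> 0"
    and aq: "qpoch (a * q) q (n + r) \<noteq> 0"
    and \<sigma>: "\<sigma>1 = a * q / \<rho>1" "\<sigma>2 = a * q / \<rho>2"
    and d: "qpoch \<sigma>1 q n \<noteq> 0" "qpoch \<sigma>2 q n \<noteq> 0"
    and c: "c = a * q / (\<rho>1 * \<rho>2)" and r: "r \<le> n"
  shows "(\<Sum>i\<le>n - r. qpoch \<rho>1 q (r + i) * qpoch \<rho>2 q (r + i) * qpoch c q (n - r - i) * c ^ (r + i) /
            (qpoch q q (n - r - i) * qpoch q q i * qpoch (a * q) q (2 * r + i))) =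
         qpoch \<sigma>1 q n * qpoch \<sigma>2 q n * (qpoch \<rho>1 q r * qpoch \<rho>2 q r * c ^ r) /
         (qpoch \<sigma>1 q r * qpoch \<sigma>2 q r * (qpoch q q (n - r) * qpoch (a * q) q (n + r)))"
proof -
  define M where "M = n - r"
  have n: "n = r + M" using r by (simp add: M_def)
  define u v where "u = \<rho>1 * q ^ r" "v = \<rho>2 * q ^ r"
  have cuv: "c * u * v = a * q * q ^ (2 * r)"
    using \<rho> by (simp add: c u_v_def mult_2 power_add)
  have cu: "c * u = \<sigma>2 * q ^ r" and cv: "c * v = \<sigma>1 * q ^ r"
    using \<rho> by (simp_all add: c \<sigma> u_v_def)
  have nr: "n + r = 2 * r + M" by (simp add: n)
  have uv: "qpoch (c * u * v) q M \<noteq> 0" and a2: "qpoch (a * q) q (2 * r) \<noteq> 0"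
    using aq unfolding nr qpoch_add cuv by auto
  have dr: "qpoch \<sigma>1 q r \<noteq> 0" "qpoch \<sigma>2 q r \<noteq> 0"
    using d[THEN qpoch_neq0_mono, OF r] by auto
  have "(\<Sum>i\<le>M. qpoch \<rho>1 q (r + i) * qpoch \<rho>2 q (r + i) * qpoch c q (M - i) * c ^ (r + i) /
            (qpoch q q (M - i) * qpoch q q i * qpoch (a * q) q (2 * r + i))) =
        qpoch \<rho>1 q r * qpoch \<rho>2 q r * c ^ r / qpoch (a * q) q (2 * r) *
        (\<Sum>i\<le>M. qpoch u q i * qpoch v q i * qpoch c q (M - i) * c ^ i /
            (qpoch q q (M - i) * qpoch q q i * qpoch (c * u * v) q i))"
    unfolding sum_distrib_left
    by (intro sum.cong refl, simp only: qpoch_add power_add cuv, simp only: u_v_def, simp add: mult_ac)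
  also have "\<dots> = qpoch \<rho>1 q r * qpoch \<rho>2 q r * c ^ r / qpoch (a * q) q (2 * r) *
      (qpoch (c * u) q M * qpoch (c * v) q M / (qpoch q q M * qpoch (c * u * v) q M))"
    by (simp only: q_saalschuetz[OF q uv])
  also have "\<dots> = qpoch \<sigma>1 q n * qpoch \<sigma>2 q n * (qpoch \<rho>1 q r * qpoch \<rho>2 q r * c ^ r) /
         (qpoch \<sigma>1 q r * qpoch \<sigma>2 q r * (qpoch q q M * qpoch (a * q) q (n + r)))"
    unfolding nr unfolding n qpoch_add cuv unfolding cu cv
    using dr by (simp add: divide_simps)
  finally show ?thesis by (simp add: M_def)
qed

lemma bailey_lemma:
  assumes q: "q \<noteq> 0" "\<And>n. qpoch q q n \<noteq> 0" and \<rho>: "\<rho>1 \<noteq> 0" "\<rho>2 \<noteq> 0"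
    and aq: "qpoch (a * q) q (2 * N) \<noteq> 0"
    and \<sigma>: "\<sigma>1 = a * q / \<rho>1" "\<sigma>2 = a * q / \<rho>2"
    and d: "qpoch \<sigma>1 q N \<noteq> 0" "qpoch \<sigma>2 q N \<noteq> 0"
    and c: "c = a * q / (\<rho>1 * \<rho>2)" and bp: "bailey_pair a q N \<alpha> \<beta>"
  shows "bailey_pair a q N
    (\<lambda>r. qpoch \<rho>1 q r * qpoch \<rho>2 q r * c ^ r / (qpoch \<sigma>1 q r * qpoch \<sigma>2 q r) * \<alpha> r)
    (\<lambda>n. (\<Sum>j\<le>n. qpoch \<rho>1 q j * qpoch \<rho>2 q j * qpoch c q (n - j) * c ^ j / qpoch q q (n - j) * \<beta> j) /
         (qpoch \<sigma>1 q n * qpoch \<sigma>2 q n))"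
  unfolding bailey_pair_def
proof (intro allI impI)
  fix n assume n: "n \<le> N"
  have dn: "qpoch \<sigma>1 q n \<noteq> 0" "qpoch \<sigma>2 q n \<noteq> 0"
    using d[THEN qpoch_neq0_mono, OF n] by auto
  have eq: "r + i + r = 2 * r + i" for r i :: nat by simp
  define w where "w j = qpoch \<rho>1 q j * qpoch \<rho>2 q j * qpoch c q (n - j) * c ^ j / qpoch q q (n - j)" for j
  have "(\<Sum>j\<le>n. w j * \<beta> j) = (\<Sum>j\<le>n. \<Sum>r\<le>j. w j * \<alpha> r / (qpoch q q (j - r) * qpoch (a * q) q (j + r)))"
  proof (intro sum.cong refl)
    fix j assume j: "j \<in> {..n}"
    then have "\<beta> j = (\<Sum>r\<le>j. \<alpha> r * (qpoch (q ^ j) (1 / q) r / qpoch q q j) / qpoch (a * q) q (j + r))"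
      using bp n by (simp add: bailey_pair_def)
    also have "\<dots> = (\<Sum>r\<le>j. \<alpha> r * (1 / qpoch q q (j - r)) / qpoch (a * q) q (j + r))"
      by (intro sum.cong refl) (subst bailey_kernel[OF q], auto)
    finally show "w j * \<beta> j = (\<Sum>r\<le>j. w j * \<alpha> r / (qpoch q q (j - r) * qpoch (a * q) q (j + r)))"
      by (simp add: sum_distrib_left)
  qed
  \<comment> \<open>Exchange the summations with j = r + i, so that the sum over i is the one
    evaluated by the conjugate pair.\<close>
  also have "(\<Sum>j\<le>n. \<Sum>r\<le>j. w j * \<alpha> r / (qpoch q q (j - r) * qpoch (a * q) q (j + r))) =
      (\<Sum>r\<le>n. \<alpha> r * (\<Sum>i\<le>n - r. qpoch \<rho>1 q (r + i) * qpoch \<rho>2 q (r + i) * qpoch c q (n - r - i) * c ^ (r + i) /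
            (qpoch q q (n - r - i) * qpoch q q i * qpoch (a * q) q (2 * r + i))))"
    unfolding sum_triangle_shift sum_distrib_left
    by (intro sum.cong refl, simp only: eq w_def, simp add: mult_ac)
  also have "\<dots> = (\<Sum>r\<le>n. \<alpha> r * (qpoch \<sigma>1 q n * qpoch \<sigma>2 q n * (qpoch \<rho>1 q r * qpoch \<rho>2 q r * c ^ r) /
         (qpoch \<sigma>1 q r * qpoch \<sigma>2 q r * (qpoch q q (n - r) * qpoch (a * q) q (n + r)))))"
  proof (intro sum.cong refl arg_cong2[where f = "(*)"] bailey_conjugate[OF q \<rho> _ \<sigma> dn c])
    fix r assume "r \<in> {..n}"
    then show "qpoch (a * q) q (n + r) \<noteq> 0"
      using n by (intro qpoch_neq0_mono[OF aq]) auto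
  qed auto
  finally have "(\<Sum>j\<le>n. w j * \<beta> j) / (qpoch \<sigma>1 q n * qpoch \<sigma>2 q n) =
     (\<Sum>r\<le>n. \<alpha> r * (qpoch \<rho>1 q r * qpoch \<rho>2 q r * c ^ r) /
         (qpoch \<sigma>1 q r * qpoch \<sigma>2 q r) * (1 / qpoch q q (n - r)) / qpoch (a * q) q (n + r))"
    using dn by (simp add: sum_divide_distrib mult_ac)
  also have "\<dots> = (\<Sum>r\<le>n. \<alpha> r * (qpoch \<rho>1 q r * qpoch \<rho>2 q r * c ^ r) /
         (qpoch \<sigma>1 q r * qpoch \<sigma>2 q r) * (qpoch (q ^ n) (1 / q) r / qpoch q q n) / qpoch (a * q) q (n + r))"
    by (intro sum.cong refl) (subst bailey_kernel[OF q], auto)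
  finally show "(\<Sum>j\<le>n. w j * \<beta> j) / (qpoch \<sigma>1 q n * qpoch \<sigma>2 q n) =
     (\<Sum>r\<le>n. qpoch \<rho>1 q r * qpoch \<rho>2 q r * c ^ r / (qpoch \<sigma>1 q r * qpoch \<sigma>2 q r) * \<alpha> r *
        qpoch (q ^ n) (1 / q) r / (qpoch q q n * qpoch (a * q) q (n + r)))"
    by (simp add: mult_ac)
qed

text \<open>Reversing both symbols of index n - j produces the terminating parameter q^(-n); the
  sign products cancel in the quotient, and of the powers only c^j and q^j survive.\<close>

lemma qpoch_ratio_reflect:
  assumes q: "q \<noteq> 0" "\<And>n. qpoch q q n \<noteq> 0" and c: "c \<noteq> 0" "qpoch c q n \<noteq> 0" and j: "j \<le> n"
  shows "qpoch c q (n - j) * c ^ j / qpoch q q (n - j) =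
         qpoch c q n / qpoch q q n * (qpoch (1 / q ^ n) q j * q ^ j / qpoch (q / (c * q ^ n)) q j)"
proof -
  have 1: "qpoch (q ^ n) (1 / q) j * qpoch q q (n - j) = qpoch q q n"
    using qpoch_falling[OF q(1) j, of 1] by simp
  have 2: "qpoch (c / q * q ^ n) (1 / q) j * qpoch c q (n - j) = qpoch c q n"
    using qpoch_falling[OF q(1) j, of "c / q"] q(1) by simp
  have r1: "qpoch (1 / q ^ n) q j = qsgn q j / (q ^ n) ^ j * qpoch (q ^ n) (1 / q) j"
    using q(1) by (intro qpoch_reflect) auto
  have eq: "q / (c * q ^ n) = 1 / (c / q * q ^ n)" using c(1) q(1) by simp
  have r2: "qpoch (q / (c * q ^ n)) q j = qsgn q j / (c / q * q ^ n) ^ j * qpoch (c / q * q ^ n) (1 / q) j"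
    unfolding eq using q(1) c(1) by (intro qpoch_reflect) auto
  have s: "qsgn q j \<noteq> 0" using q(1) by (simp add: qsgn_def)
  have nz: "qpoch q q (n - j) \<noteq> 0" "qpoch (q ^ n) (1 / q) j \<noteq> 0"
    "qpoch c q (n - j) \<noteq> 0" "qpoch (c / q * q ^ n) (1 / q) j \<noteq> 0"
    using 1 2 q(2)[of n] c(2) by auto
  show ?thesis
    unfolding r1 r2 1[symmetric] 2[symmetric]
    using nz s q(1) c(1) by (simp add: power_mult_distrib power_divide)
qed

text \<open>The form in which the sums of \<^const>\<open>U\<close>, \<^const>\<open>V\<close> and \<^const>\<open>T\<close> appear.\<close>

lemma bailey_lemma_terminating:
  assumes q: "q \<noteq> 0" "\<And>n. qpoch q q n \<noteq> 0" and \<rho>: "a \<noteq> 0" "\<rho>1 \<noteq> 0" "\<rho>2 \<noteq> 0"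
    and aq: "qpoch (a * q) q (2 * N) \<noteq> 0"
    and \<sigma>: "\<sigma>1 = a * q / \<rho>1" "\<sigma>2 = a * q / \<rho>2"
    and d: "qpoch \<sigma>1 q N \<noteq> 0" "qpoch \<sigma>2 q N \<noteq> 0"
    and c: "c = a * q / (\<rho>1 * \<rho>2)" "qpoch c q N \<noteq> 0" and bp: "bailey_pair a q N \<alpha> \<beta>"
  shows "bailey_pair a q N
    (\<lambda>r. qpoch \<rho>1 q r * qpoch \<rho>2 q r * c ^ r / (qpoch \<sigma>1 q r * qpoch \<sigma>2 q r) * \<alpha> r)
    (\<lambda>n. qpoch c q n / (qpoch q q n * qpoch \<sigma>1 q n * qpoch \<sigma>2 q n) *
         (\<Sum>j\<le>n. qpoch (1 / q ^ n) q j * qpoch \<rho>1 q j * qpoch \<rho>2 q j * q ^ j /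
            qpoch (\<rho>1 * \<rho>2 / (a * q ^ n)) q j * \<beta> j))"
    (is "bailey_pair a q N ?\<alpha> ?\<beta>")
proof -
  have c0: "c \<noteq> 0" using c \<rho> q by simp
  have eq: "\<rho>1 * \<rho>2 / (a * q ^ n) = q / (c * q ^ n)" for n
    using c \<rho> q by simp
  have "?\<beta> n = (\<Sum>j\<le>n. qpoch \<rho>1 q j * qpoch \<rho>2 q j * qpoch c q (n - j) * c ^ j / qpoch q q (n - j) * \<beta> j) /
         (qpoch \<sigma>1 q n * qpoch \<sigma>2 q n)" (is "_ = ?R") if "n \<le> N" for n
  proof -
    have cn: "qpoch c q n \<noteq> 0" using c(2) that by (rule qpoch_neq0_mono)
    have "?R = (\<Sum>j\<le>n. qpoch \<rho>1 q j * qpoch \<rho>2 q j * (qpoch c q (n - j) * c ^ j / qpoch q q (n - j)) * \<beta> j) /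
         (qpoch \<sigma>1 q n * qpoch \<sigma>2 q n)"
      by (simp add: mult_ac)
    also have "\<dots> = (\<Sum>j\<le>n. qpoch \<rho>1 q j * qpoch \<rho>2 q j *
           (qpoch c q n / qpoch q q n * (qpoch (1 / q ^ n) q j * q ^ j / qpoch (q / (c * q ^ n)) q j)) * \<beta> j) /
         (qpoch \<sigma>1 q n * qpoch \<sigma>2 q n)"
      by (intro arg_cong2[where f = "(/)"] sum.cong refl) (subst qpoch_ratio_reflect[OF q c0 cn], auto)
    also have "\<dots> = ?\<beta> n"
      unfolding eq sum_distrib_left sum_divide_distrib
      by (intro sum.cong refl) (simp add: mult_ac)
    finally show ?thesis by simp
  qed
  then show ?thesis
    using bailey_lemma[OF q \<rho>(2,3) aq \<sigma> d c(1) bp] unfolding bailey_pair_def by simp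
qed

text \<open>The \<alpha> side of the unit Bailey pair relative to a.\<close>

definition unit_alpha :: "complex \<Rightarrow> complex \<Rightarrow> nat \<Rightarrow> complex" where
  "unit_alpha a q r = qsgn q r * (1 - a * q ^ (2 * r)) * qpoch a q r / ((1 - a) * qpoch q q r)"

text \<open>For n > 0 the defining sum telescopes: the terms below n add up to \<open>G n\<close>,
  and the term at n is \<open>- G n\<close>.\<close>

lemma bailey_pair_unit:
  assumes q: "q \<noteq> 0" "\<And>n. qpoch q q n \<noteq> 0" and a: "a \<noteq> 1" and aq: "qpoch (a * q) q (2 * N) \<noteq> 0"
  shows "bailey_pair a q N (unit_alpha a q) (\<lambda>n. if n = 0 then 1 else 0)"
  unfolding bailey_pair_def
proof (intro allI impI)
  fix n assume n: "n \<le> N"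
  define t where "t r = unit_alpha a q r * qpoch (q ^ n) (1 / q) r / (qpoch q q n * qpoch (a * q) q (n + r))" for r
  \<comment> \<open>\<open>X r\<close> is the term stripped of its very-well-poised factor 1 - a
    q^(2r).\<close>
  define X where "X r = qsgn q r * qpoch a q r * qpoch (q ^ n) (1 / q) r /
     ((1 - a) * qpoch q q r * qpoch q q n * qpoch (a * q) q (n + r))" for r
  define G where "G r = - X r * (1 - q ^ r) * (1 - a * q ^ n * q ^ r) / (1 - q ^ n)" for r
  have tX: "t r = X r * (1 - a * q ^ r * q ^ r)" for r
    unfolding t_def X_def unit_alpha_def mult_2 power_add by (simp add: mult_ac)
  have "(\<Sum>r\<le>n. t r) = 0" if n0: "n \<noteq> 0"
  proof -
    have ne: "1 - q * q ^ i \<noteq> 0" for i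
      using q(2)[of "Suc i"] by (simp add: qpoch_Suc)
    have nQ: "1 - q ^ n \<noteq> 0" using ne[of "n - 1"] n0 by (simp flip: power_Suc)
    \<comment> \<open>The bound is strict because the factor 1 - a q^(n+r+1) is divided by, and n +
      r + 1 \<le> 2N is guaranteed only for r < n.\<close>
    have step: "t r = G (Suc r) - G r" if "r < n" for r
    proof -
      define z where "z = q ^ r"
      have "qpoch (a * q) q (Suc (n + r)) \<noteq> 0"
        using that n by (intro qpoch_neq0_mono[OF aq]) auto
      then have 1: "1 - a * q * q ^ n * z \<noteq> 0"
        by (simp add: qpoch_Suc z_def power_add mult_ac)
      have 2: "1 - q * z \<noteq> 0" using ne[of r] by (simp add: z_def)
      have z0: "z \<noteq> 0" using q by (simp add: z_def)
      have "X (Suc r) = - X r * z * (1 - a * z) * (1 - q ^ n / z) / ((1 - q * z) * (1 - a * q * q ^ n * z))"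
        by (simp add: X_def qsgn_Suc qpoch_Suc power_add power_one_over mult_ac flip: z_def)
      then have XS: "X (Suc r) * (1 - q * z) * (1 - a * q ^ n * (q * z)) = - X r * (1 - a * z) * (z - q ^ n)"
        using 1 2 z0 by (simp add: divide_simps mult_ac)
      have "G (Suc r) - G r = (- (X (Suc r) * (1 - q * z) * (1 - a * q ^ n * (q * z))) +
          X r * (1 - z) * (1 - a * q ^ n * z)) / (1 - q ^ n)"
        by (simp add: G_def diff_divide_distrib flip: z_def)
      also have "\<dots> = X r * (1 - a * z * z) * (1 - q ^ n) / (1 - q ^ n)"
        unfolding XS by (rule arg_cong2[where f = "(/)"]) (algebra, rule refl)
      finally show ?thesis
        using nQ by (simp add: tX flip: z_def)
    qed
    have "(\<Sum>r<m. t r) = G m - G 0" if "m \<le> n" for m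
      using that by (induction m) (auto simp: step)
    then have "(\<Sum>r<n. t r) = G n" by (simp add: G_def)
    then show ?thesis
      using nQ by (simp add: lessThan_Suc_atMost[symmetric] tX G_def)
  qed
  moreover have "(\<Sum>r\<le>0. t r) = 1" if "n = 0"
    using that a by (simp add: t_def unit_alpha_def)
  ultimately show "(if n = 0 then 1 else 0) = (\<Sum>r\<le>n. unit_alpha a q r * qpoch (q ^ n) (1 / q) r / (qpoch q q n * qpoch (a * q) q (n + r)))"
    unfolding t_def[symmetric] by auto
qed

section \<open>The cubic Bailey pair\<close>

text \<open>Indexed by r, this is the value of \<alpha> at 3r.\<close>

definition cubic_alpha :: "complex \<Rightarrow> complex \<Rightarrow> nat \<Rightarrow> complex" where
  "cubic_alpha a q r = qsgn q (3 * r) * a ^ r * (1 - a * q ^ (6 * r)) * qpoch a (q ^ 3) r /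
     ((1 - a) * qpoch (q ^ 3) (q ^ 3) r)"

lemma sum_multiples_of_3:
  fixes f :: "nat \<Rightarrow> complex"
  shows "(\<Sum>r\<le>n. if 3 dvd r then f r else 0) = (\<Sum>r\<le>n div 3. f (3 * r))"
proof -
  have "(\<Sum>r\<le>n. if 3 dvd r then f r else 0) = (\<Sum>r | r \<le> n \<and> 3 dvd r. f r)"
    by (simp add: sum.If_cases Int_def)
  also have "\<dots> = (\<Sum>r\<le>n div 3. f (3 * r))"
    by (rule sum.reindex_bij_witness[where i = "\<lambda>r. 3 * r" and j = "\<lambda>r. r div 3"]) auto
  finally show ?thesis .
qed

text \<open>The sum is a very-well-poised \<open>\<^sub>6\<phi>\<^sub>5\<close> in base \<open>q\<^sup>3\<close> with numerator parameters
  \<open>q\<^bsup>-n\<^esup>, q\<^bsup>1-n\<^esup>, q\<^bsup>2-n\<^esup>\<close>. Raising \<open>n\<close> by one only replaces \<open>q\<^bsup>2-n\<^esup>\<close> by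
  \<open>q\<^bsup>2-n\<^esup> / q\<^sup>3\<close>, a contiguous parameter, so there is a first-order recurrence in \<open>n\<close>, certified
  by the telescoping term \<open>G\<close>.\<close>

lemma bailey_pair_cubic:
  assumes q: "q \<noteq> 0" "\<And>n. qpoch q q n \<noteq> 0" "\<And>n. qpoch (q ^ 3) (q ^ 3) n \<noteq> 0"
    and a: "a \<noteq> 1" and aq: "qpoch (a * q) q (2 * N) \<noteq> 0" "qpoch a q (2 * N) \<noteq> 0"
  shows "bailey_pair a q N (\<lambda>r. if 3 dvd r then cubic_alpha a q (r div 3) else 0)
           (\<lambda>n. qpoch a (q ^ 3) n / (qpoch q q n * qpoch a q (2 * n)))"
proof -
  define F where "F n r = cubic_alpha a q r * qpoch (q ^ n) (1 / q) (3 * r) / (qpoch q q n * qpoch (a * q) q (n + 3 * r))" for n r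
  define S where "S n = (\<Sum>r\<le>n div 3. F n r)" for n
  have ne: "1 - q * q ^ i \<noteq> 0" for i
    using q(2)[of "Suc i"] by (simp add: qpoch_Suc)
  \<comment> \<open>The coefficients are those by which the claimed \<beta> changes from n to n +
    1.\<close>
  have rec: "(1 - q * q ^ n) * (1 - a * q ^ n * q ^ n) * (1 - a * q * q ^ n * q ^ n) * S (Suc n) =
      (1 - a * q ^ n * q ^ n * q ^ n) * S n" if n: "Suc n \<le> N" for n
  proof -
    define R where "R = Suc n div 3"
    define Q where "Q = q ^ n"
    \<comment> \<open>A possible extra index has 3r > n, where the falling product vanishes; both
      sums can thus run to \<open>R\<close>.\<close>
    have "(\<Sum>r\<le>n div 3. F n r) = (\<Sum>r\<le>R. F n r)"
      using q(1) by (intro sum.mono_neutral_left) (auto simp: R_def F_def intro!: qpoch_falling_eq_0 div_le_mono)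
    then have S: "S n = (\<Sum>r\<le>R. F n r)" "S (Suc n) = (\<Sum>r\<le>R. F (Suc n) r)"
      by (simp_all add: S_def R_def)
    define X where "X r = qsgn q (3 * r) * a ^ r * qpoch a (q ^ 3) r * qpoch (q ^ Suc n) (1 / q) (3 * r) /
      ((1 - a) * qpoch (q ^ 3) (q ^ 3) r * qpoch q q (Suc n) * qpoch (a * q) q (Suc n + 3 * r))" for r
    \<comment> \<open>\<open>H r\<close> is \<open>G (Suc r)\<close> with the denominators of
      \<open>X (Suc r)\<close> cancelled. It stays meaningful at r = R, where the symbol in
      \<open>G (Suc R)\<close> may reach beyond the range in which (aq;q) is known to be
      nonzero.\<close>
    define H where "H r = X r * q * Q * a * (q ^ (3 * r)) ^ 2 * (1 - a * q ^ (3 * r)) * (1 - q * Q / q ^ (3 * r)) *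
      (1 - Q / q ^ (3 * r)) * (1 - Q / (q * q ^ (3 * r)))" for r
    define G where "G r = - X r * q * Q / q ^ (3 * r) * (1 - q ^ (3 * r)) * (1 - a * Q * q * q ^ (3 * r)) *
      (1 - a * Q * q ^ (3 * r)) * (1 - a * Q * q ^ (3 * r) / q)" for r
    have step: "(1 - q * Q) * (1 - a * Q * Q) * (1 - a * q * Q * Q) * F (Suc n) r - (1 - a * Q * Q * Q) * F n r =
      H r - G r" if r: "r \<le> R" for r
    proof -
      define z where "z = q ^ (3 * r)"
      have z0: "z \<noteq> 0" using q by (simp add: z_def)
      have "qpoch (a * q) q (Suc (n + 3 * r)) \<noteq> 0"
        using r n by (intro qpoch_neq0_mono[OF aq(1)]) (auto simp: R_def)
      then have 1: "1 - a * q * Q * z \<noteq> 0"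
        by (simp add: qpoch_Suc z_def Q_def power_add mult_ac)
      have 2: "1 - q * Q \<noteq> 0" using ne[of n] by (simp add: Q_def)
      have q6: "q ^ (6 * r) = z * z" by (simp add: z_def flip: power_add)
      have F1: "F (Suc n) r = X r * (1 - a * z * z)"
        unfolding F_def X_def cubic_alpha_def q6 by (simp add: mult_ac)
      have fall: "qpoch (q ^ Suc n) (1 / q) (3 * r) * (1 - q * Q / z) = (1 - q * Q) * qpoch (q ^ n) (1 / q) (3 * r)"
        using qpoch_falling_Suc[of q 1 n "3 * r"] q(1)
        by (simp add: Q_def z_def qpoch_Suc power_one_over mult_ac)
      then have fall': "qpoch (q ^ n) (1 / q) (3 * r) = qpoch (q ^ Suc n) (1 / q) (3 * r) * (1 - q * Q / z) / (1 - q * Q)"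
        using 2 by (simp add: field_simps)
      have aq': "qpoch (a * q) q (Suc n + 3 * r) = qpoch (a * q) q (n + 3 * r) * (1 - a * q * Q * z)"
        by (simp add: qpoch_Suc Q_def z_def power_add mult_ac)
      have F2: "F n r = X r * (1 - a * z * z) * (1 - q * Q / z) * (1 - a * q * Q * z)"
        unfolding F_def X_def cubic_alpha_def q6 fall' aq' qpoch_Suc power_Suc
        unfolding Q_def[symmetric]
        using 1 2 by (simp add: mult_ac)
      show ?thesis
        unfolding F1 F2 H_def G_def z_def[symmetric]
        using z0 q(1) by (simp add: field_simps) algebra
    qed
    have HG: "H r = G (Suc r)" if r: "r < R" for r
    proof -
      define z where "z = q ^ (3 * r)"
      have z0: "z \<noteq> 0" using q by (simp add: z_def)
      have "qpoch (a * q) q (Suc (Suc (Suc (Suc n + 3 * r)))) \<noteq> 0"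
        using r n by (intro qpoch_neq0_mono[OF aq(1)]) (auto simp: R_def)
      then have 1: "1 - a * q * (q * Q * z) \<noteq> 0" "1 - a * q * (q * (q * Q * z)) \<noteq> 0" "1 - a * q * (q * (q * (q * Q * z))) \<noteq> 0"
        by (simp_all add: qpoch_Suc z_def Q_def power_add mult_ac)
      have 2: "1 - q ^ 3 * z \<noteq> 0"
        using q(3)[of "Suc r"] by (simp add: qpoch_Suc z_def power_mult)
      have 3: "3 * Suc r = Suc (Suc (Suc (3 * r)))" by simp
      have zz: "(q ^ 3) ^ r = z" by (simp add: z_def power_mult)
      have zs: "q ^ (3 * Suc r) = q ^ 3 * z" by (simp add: z_def power_add)
      have e: "q ^ (Suc n + 3 * r) = q * Q * z" "q ^ Suc n = q * Q"
        by (simp_all add: z_def Q_def power_add)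
      have X: "X (Suc r) = - X r * z * (q * z) * (q * (q * z)) * a * (1 - a * z) *
          (1 - q * Q / z) * (1 - q * Q / (q * z)) * (1 - q * Q / (q * (q * z))) /
          ((1 - q ^ 3 * z) * ((1 - a * q * (q * Q * z)) * (1 - a * q * (q * (q * Q * z))) * (1 - a * q * (q * (q * (q * Q * z))))))"
        unfolding X_def 3 qsgn_Suc qpoch_Suc add_Suc_right power_Suc power_one_over e zz z_def[symmetric] Q_def[symmetric]
        by (simp add: mult_ac)
      show ?thesis
        unfolding H_def G_def X zs z_def[symmetric]
        using 1 2 z0 q(1) by (simp add: divide_simps power2_eq_square power3_eq_cube mult_ac)
    qed
    \<comment> \<open>Since Suc n < 3R + 3, the falling product of length 3R + 3 vanishes; its last
      three factors are the explicit ones in \<open>H R\<close>.\<close>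
    have HR: "H R = 0"
    proof -
      have "qpoch (q ^ Suc n) (1 / q) (Suc (Suc (Suc (3 * R)))) = 0"
        using q(1) by (intro qpoch_falling_eq_0) (auto simp: R_def)
      then show ?thesis
        using q(1) by (auto simp: H_def X_def qpoch_Suc Q_def power_one_over mult_ac)
    qed
    have "(\<Sum>r<m. H r - G r) = G m - G 0" if "m \<le> R" for m
      using that by (induction m) (auto simp: HG)
    then have "(\<Sum>r<R. H r - G r) = G R" by (simp add: G_def)
    then have "(\<Sum>r\<le>R. H r - G r) = 0"
      by (simp add: lessThan_Suc_atMost[symmetric] HR)
    moreover have "(1 - q * Q) * (1 - a * Q * Q) * (1 - a * q * Q * Q) * S (Suc n) - (1 - a * Q * Q * Q) * S n =
      (\<Sum>r\<le>R. H r - G r)"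
      unfolding S sum_distrib_left sum_subtractf[symmetric] by (intro sum.cong refl step) simp
    ultimately show ?thesis by (simp add: Q_def)
  qed
  have S: "S n = qpoch a (q ^ 3) n / (qpoch q q n * qpoch a q (2 * n))" if "n \<le> N" for n
    using that
  proof (induction n)
    case 0
    show ?case using a by (simp add: S_def F_def cubic_alpha_def)
  next
    case (Suc n)
    define Q where "Q = q ^ n"
    have e: "q ^ (2 * n) = Q * Q" "(q ^ 3) ^ n = Q * Q * Q"
      by (simp_all add: Q_def mult_2 power_add power3_eq_cube power_mult_distrib)
    have 2: "2 * Suc n = Suc (Suc (2 * n))" by simp
    have "qpoch a q (2 * Suc n) \<noteq> 0"
      using Suc.prems by (intro qpoch_neq0_mono[OF aq(2)]) auto
    then have nz: "1 - a * (Q * Q) \<noteq> 0" "1 - a * (q * (Q * Q)) \<noteq> 0"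
      unfolding 2 by (simp_all add: qpoch_Suc e)
    have nq: "1 - q * Q \<noteq> 0" using ne[of n] by (simp add: Q_def)
    have "S (Suc n) = (1 - a * (Q * Q * Q)) * S n /
        ((1 - q * Q) * ((1 - a * (Q * Q)) * (1 - a * (q * (Q * Q)))))"
      using rec[OF Suc.prems] nz nq
      by (subst nonzero_eq_divide_eq) (simp_all add: mult_ac flip: Q_def)
    then show ?case
      using Suc unfolding 2 qpoch_Suc power_Suc e Q_def[symmetric] by (simp add: mult_ac)
  qed
  have "(\<Sum>r\<le>n. (if 3 dvd r then cubic_alpha a q (r div 3) else 0) * qpoch (q ^ n) (1 / q) r /
             (qpoch q q n * qpoch (a * q) q (n + r))) = S n" for n
  proof -
    have "(\<Sum>r\<le>n. (if 3 dvd r then cubic_alpha a q (r div 3) else 0) * qpoch (q ^ n) (1 / q) r /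
             (qpoch q q n * qpoch (a * q) q (n + r))) =
        (\<Sum>r\<le>n. if 3 dvd r then cubic_alpha a q (r div 3) * qpoch (q ^ n) (1 / q) r /
             (qpoch q q n * qpoch (a * q) q (n + r)) else 0)"
      by (intro sum.cong) auto
    then show ?thesis by (simp add: sum_multiples_of_3 S_def F_def)
  qed
  then show ?thesis unfolding bailey_pair_def by (simp add: S)
qed

section \<open>The triple-sum transformation\<close>

theorem theorem2p5:
  fixes n :: nat and q a x y :: complex
  assumes "q \<noteq> 0" and "a \<noteq> 0" and "x \<noteq> 0" and "y \<noteq> 0" and "norm q < 1"
    \<comment> \<open>no denominator factor of \<open>U\<close> vanishes\<close>
    and "\<And>j. j \<le> n \<Longrightarrow> qpoch (q ^ 3) (q ^ 3) j \<noteq> 0"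
    and "\<And>j. j \<le> n \<Longrightarrow> qpoch (a * q ^ 2 / y) (q ^ 3) j \<noteq> 0"
    and "\<And>j. j \<le> n \<Longrightarrow> qpoch (a * q / y) (q ^ 3) j \<noteq> 0"
    and "\<And>j. j \<le> n \<Longrightarrow> qpoch (q powi (3 - 9 * int n) / a) (q ^ 3) j \<noteq> 0"
    \<comment> \<open>nor of \<open>V\<close>\<close>
    and "\<And>k. k \<le> n \<Longrightarrow> qpoch (a * q / x) (q ^ 3) k \<noteq> 0"
    and "\<And>k. k \<le> n \<Longrightarrow> qpoch (a * q ^ 3 / y) (q ^ 3) k \<noteq> 0"
    and "\<And>j k. k \<le> j \<Longrightarrow> j \<le> n \<Longrightarrow>
           qpoch (y ^ 2 * q powi (3 - 3 * int j) / a) (q ^ 3) k \<noteq> 0"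
    \<comment> \<open>nor of \<open>T\<close>\<close>
    and "\<And>m. m \<le> n \<Longrightarrow> qpoch (a * q ^ 2 / x) (q ^ 3) m \<noteq> 0"
    and "\<And>m. m \<le> n \<Longrightarrow> qpoch (a * q ^ 3 / x) (q ^ 3) m \<noteq> 0"
    and "\<And>k m. m \<le> k \<Longrightarrow> k \<le> n \<Longrightarrow>
           qpoch (x * y * q powi (2 - 3 * int k) / a) (q ^ 3) m \<noteq> 0"
    \<comment> \<open>nor of the right-hand side\<close>
    and "qpoch (a * q / x) q (3 * n) \<noteq> 0"
    and "qpoch (a * q / y) q (3 * n) \<noteq> 0"
    and "qpoch (a * q ^ 3) (q ^ 3) n \<noteq> 0"
    and "qpoch (a * q ^ (6 * n)) (q ^ 3) n \<noteq> 0"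
    and "\<And>j. j \<le> 3 * n \<Longrightarrow> qpoch q q j \<noteq> 0"
    and "\<And>j. j \<le> 3 * n \<Longrightarrow> qpoch a q (2 * j) \<noteq> 0"
    and "\<And>j. j \<le> 3 * n \<Longrightarrow> qpoch (x * y * q powi (- 3 * int n) / a) q j \<noteq> 0"
  shows "(\<Sum>j=0..n. \<Sum>k=0..j. \<Sum>m=0..k. U n q a y j * V q a x y j k * T q a x y k m) =
    (qpoch (a * q) q (3 * n) * qpoch (a * q / (x * y)) q (3 * n) *
     qpoch (a * q ^ (3 * n + 1)) (q ^ 3) n * qpoch (a * q ^ (3 * n + 2)) (q ^ 3) n) /
    (qpoch (a * q / x) q (3 * n) * qpoch (a * q / y) q (3 * n) *
     qpoch (a * q ^ 3) (q ^ 3) n * qpoch (a * q ^ (6 * n)) (q ^ 3) n) *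
    (\<Sum>j=0..3 * n.
       (qpoch a (q ^ 3) j * qpoch x q j * qpoch y q j * qpoch (q powi (- 3 * int n)) q j * q ^ j) /
       (qpoch q q j * qpoch a q (2 * j) * qpoch (x * y * q powi (- 3 * int n) / a) q j))"
proof (cases "n = 0")
  case True
  then show ?thesis by (simp add: U_def V_def T_def)
next
  case False

  \<comment> \<open>Nonvanishing of the symbols containing only a and q\<close>
  note q0 = assms(1) and a0 = assms(2) and x0 = assms(3) and y0 = assms(4) and nq = assms(5)
  define p where "p = q ^ 3"
  have p0: "p \<noteq> 0" using q0 by (simp add: p_def)
  have np: "norm p < 1"
    using nq unfolding p_def norm_power by (intro power_less_one_iff[THEN iffD2]) auto
  note qq = qpoch_base_neq0[OF nq] and pp = qpoch_base_neq0[OF np]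
  have pn: "p ^ k = q ^ (3 * k)" for k by (simp add: p_def power_mult)
  \<comment> \<open>Exponents below 6n come from (a;q)_(6n); the exponent 6n is the first factor of
    (aq^(6n);q^3)_n, which exists because n is positive.\<close>
  have aq: "a * q ^ i \<noteq> 1" if "i \<le> 6 * n" for i
  proof (cases "i = 6 * n")
    case True
    have "qpoch (a * q ^ (6 * n)) (q ^ 3) n \<noteq> 0" by (rule assms)
    then have "a * q ^ (6 * n) * (q ^ 3) ^ 0 \<noteq> 1"
      using False unfolding qpoch_neq0_iff by blast
    then show ?thesis using True by simp
  next
    case False
    have "qpoch a q (2 * (3 * n)) \<noteq> 0" by (rule assms) simp
    then show ?thesis using False that by (auto simp: qpoch_neq0_iff)
  qed
  have a1: "a \<noteq> 1" using aq[of 0] by simp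
  have Aq: "qpoch (a * q) q (2 * (3 * n)) \<noteq> 0"
    unfolding qpoch_neq0_iff using aq[of "Suc _"] by (auto simp: mult_ac)
  have Ap: "qpoch (a * p) p (2 * n) \<noteq> 0"
    unfolding qpoch_neq0_iff
  proof (intro allI impI)
    fix i assume "i < 2 * n"
    moreover have "a * p * p ^ i = a * q ^ (3 * Suc i)" by (simp only: pn) (simp add: p_def power_add)
    ultimately show "a * p * p ^ i \<noteq> 1" using aq[of "3 * Suc i"] by (simp only:) simp
  qed
  have A1: "qpoch (a * q * p ^ n) p n \<noteq> 0" and A2: "qpoch (a * q ^ 2 * p ^ n) p n \<noteq> 0"
    unfolding qpoch_neq0_iff
  proof safe
    fix i assume i: "i < n"
    have "a * q * p ^ n * p ^ i = a * q ^ (3 * n + 3 * i + 1)" "a * q ^ 2 * p ^ n * p ^ i = a * q ^ (3 * n + 3 * i + 2)"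
      by (simp_all add: pn power_add power2_eq_square mult_ac)
    then show "a * q * p ^ n * p ^ i = 1 \<Longrightarrow> False" "a * q ^ 2 * p ^ n * p ^ i = 1 \<Longrightarrow> False"
      using aq[of "3 * n + 3 * i + 1"] aq[of "3 * n + 3 * i + 2"] i by simp_all
  qed
  have powi: "q powi (- 3 * int k) = 1 / p ^ k" "q powi (3 - 3 * int k) = p / p ^ k"
    "q powi (2 - 3 * int k) = q ^ 2 / p ^ k" "q powi (3 - 9 * int k) = p / p ^ (3 * k)" for k
  proof -
    have "q powi (3 * int k) = p ^ k" "q powi (9 * int k) = p ^ (3 * k)"
      using power_int_of_nat[of q "3 * k"] power_int_of_nat[of q "9 * k"] by (simp_all add: pn)
    then show "q powi (- 3 * int k) = 1 / p ^ k" "q powi (3 - 3 * int k) = p / p ^ k"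
    "q powi (2 - 3 * int k) = q ^ 2 / p ^ k" "q powi (3 - 9 * int k) = p / p ^ (3 * k)"
      using q0 by (simp_all add: power_int_diff p_def power_int_minus field_simps)
  qed

  \<comment> \<open>These are the quotients a p / (\<rho>1 \<rho>2) of the four applications in base
    p; \<open>c2\<close> is also the quotient a q / (x y) of the application in base q.\<close>
  define c1 where "c1 = a * q ^ 2 / x ^ 2"
  define c2 where "c2 = a * q / (x * y)"
  define c3 where "c3 = a / y ^ 2"
  define c4 where "c4 = a * q ^ (6 * n)"
  have c4': "c4 = a * p ^ (2 * n)" by (simp add: c4_def pn)
  \<comment> \<open>The last denominators of T and V at k = n and j = n are the reversals of the
    symbols of \<open>c2\<close> and \<open>c3\<close>; the right-hand side gives the base q version
    for \<open>c2\<close>.\<close>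
  have C2: "qpoch c2 p n \<noteq> 0"
  proof (rule qpoch_neq0_reverse[OF p0])
    have "qpoch (x * y * q powi (2 - 3 * int n) / a) (q ^ 3) n \<noteq> 0" by (rule assms) simp_all
    moreover have "x * y * q powi (2 - 3 * int n) / a = p / (c2 * p ^ n)"
      unfolding powi c2_def using q0 a0 x0 y0 by (simp add: p_def power2_eq_square power3_eq_cube mult_ac)
    ultimately show "qpoch (p / (c2 * p ^ n)) p n \<noteq> 0" by (simp add: p_def)
  qed (use a0 q0 x0 y0 in \<open>simp add: c2_def\<close>)
  have C3: "qpoch c3 p n \<noteq> 0"
  proof (rule qpoch_neq0_reverse[OF p0])
    have "qpoch (y ^ 2 * q powi (3 - 3 * int n) / a) (q ^ 3) n \<noteq> 0" by (rule assms) simp_all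
    moreover have "y ^ 2 * q powi (3 - 3 * int n) / a = p / (c3 * p ^ n)"
      unfolding powi c3_def using q0 a0 x0 y0 by (simp add: mult_ac)
    ultimately show "qpoch (p / (c3 * p ^ n)) p n \<noteq> 0" by (simp add: p_def)
  qed (use a0 q0 x0 y0 in \<open>simp add: c3_def\<close>)
  have C4: "qpoch c4 p n \<noteq> 0" unfolding c4_def p_def by (rule assms)
  have C: "qpoch c2 q (3 * n) \<noteq> 0"
  proof (rule qpoch_neq0_reverse[OF q0])
    have "qpoch (x * y * q powi (- 3 * int n) / a) q (3 * n) \<noteq> 0" by (rule assms) simp_all
    moreover have "x * y * q powi (- 3 * int n) / a = q / (c2 * q ^ (3 * n))"
      unfolding powi c2_def using q0 a0 x0 y0 by (simp add: pn mult_ac)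
    ultimately show "qpoch (q / (c2 * q ^ (3 * n))) q (3 * n) \<noteq> 0" by simp
  qed (use a0 q0 x0 y0 in \<open>simp add: c2_def\<close>)

  \<comment> \<open>The chain of Bailey pairs in base p\<close>
  define \<beta>1 where "\<beta>1 m = qpoch c1 p m / (qpoch p p m * qpoch (a * q ^ 2 / x) p m * qpoch (a * q ^ 3 / x) p m)" for m
  define \<alpha>1 where "\<alpha>1 r = qpoch (x * q) p r * qpoch x p r * c1 ^ r /
     (qpoch (a * q ^ 2 / x) p r * qpoch (a * q ^ 3 / x) p r) * unit_alpha a p r" for r
  have "bailey_pair a p n \<alpha>1 (\<lambda>n. (\<Sum>j\<le>n. qpoch (x * q) p j * qpoch x p j * qpoch c1 p (n - j) * c1 ^ j / qpoch p p (n - j) *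
      (if j = 0 then 1 else 0)) / (qpoch (a * q ^ 2 / x) p n * qpoch (a * q ^ 3 / x) p n))"
    unfolding \<alpha>1_def
  proof (rule bailey_lemma[OF p0 pp _ _ Ap _ _ _ _ _ bailey_pair_unit[OF p0 pp a1 Ap]])
    show "qpoch (a * q\<^sup>2 / x) p n \<noteq> 0" "qpoch (a * q ^ 3 / x) p n \<noteq> 0"
      unfolding p_def by (rule assms, simp)+
  qed (use q0 x0 in \<open>simp_all add: c1_def p_def power2_eq_square power3_eq_cube\<close>)
  \<comment> \<open>The unit \<beta> leaves only the term j = 0, so the first application yields a
    closed product.\<close>
  moreover have "(\<Sum>j\<le>m. f j * (if j = 0 then 1 else 0)) = f 0" for f :: "nat \<Rightarrow> complex" and m :: nat
    by (induction m) auto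
  ultimately have B1: "bailey_pair a p n \<alpha>1 \<beta>1"
    by (simp only: \<beta>1_def[abs_def]) (simp add: mult_ac)

  define \<beta>2 where "\<beta>2 k = qpoch c2 p k / (qpoch p p k * qpoch (a * q / x) p k * qpoch (a * q ^ 3 / y) p k) *
     (\<Sum>m\<le>k. qpoch (1 / p ^ k) p m * qpoch (x * q ^ 2) p m * qpoch y p m * p ^ m /
            qpoch (x * q ^ 2 * y / (a * p ^ k)) p m * \<beta>1 m)" for k
  define \<alpha>2 where "\<alpha>2 r = qpoch (x * q ^ 2) p r * qpoch y p r * c2 ^ r /
     (qpoch (a * q / x) p r * qpoch (a * q ^ 3 / y) p r) * \<alpha>1 r" for r
  have B2: "bailey_pair a p n \<alpha>2 \<beta>2"
    unfolding \<alpha>2_def \<beta>2_def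
  proof (rule bailey_lemma_terminating[OF p0 pp a0 _ _ Ap _ _ _ _ _ C2 B1])
    show "qpoch (a * q / x) p n \<noteq> 0" "qpoch (a * q ^ 3 / y) p n \<noteq> 0"
      unfolding p_def by (rule assms, simp)+
  qed (use q0 x0 y0 in \<open>simp_all add: c2_def p_def power2_eq_square power3_eq_cube\<close>)

  define \<beta>3 where "\<beta>3 j = qpoch c3 p j / (qpoch p p j * qpoch (a * q ^ 2 / y) p j * qpoch (a * q / y) p j) *
     (\<Sum>k\<le>j. qpoch (1 / p ^ j) p k * qpoch (y * q) p k * qpoch (y * q ^ 2) p k * p ^ k /
            qpoch (y * q * (y * q ^ 2) / (a * p ^ j)) p k * \<beta>2 k)" for j
  define \<alpha>3 where "\<alpha>3 r = qpoch (y * q) p r * qpoch (y * q ^ 2) p r * c3 ^ r /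
     (qpoch (a * q ^ 2 / y) p r * qpoch (a * q / y) p r) * \<alpha>2 r" for r
  have B3: "bailey_pair a p n \<alpha>3 \<beta>3"
    unfolding \<alpha>3_def \<beta>3_def
  proof (rule bailey_lemma_terminating[OF p0 pp a0 _ _ Ap _ _ _ _ _ C3 B2])
    show "qpoch (a * q ^ 2 / y) p n \<noteq> 0" "qpoch (a * q / y) p n \<noteq> 0"
      unfolding p_def by (rule assms, simp)+
  qed (use q0 x0 y0 in \<open>simp_all add: c3_def p_def power2_eq_square power3_eq_cube\<close>)

  \<comment> \<open>The parameters q^(1-3n) and q^(2-3n) join the terminating p^(-n) to form
    (q^(-3n);q)_(3j) in U.\<close>
  define S where "S = (\<Sum>j\<le>n. qpoch (1 / p ^ n) p j * qpoch (q / p ^ n) p j * qpoch (q ^ 2 / p ^ n) p j * p ^ j /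
            qpoch (q / p ^ n * (q ^ 2 / p ^ n) / (a * p ^ n)) p j * \<beta>3 j)"
  define \<alpha>4 where "\<alpha>4 r = qpoch (q / p ^ n) p r * qpoch (q ^ 2 / p ^ n) p r * c4 ^ r /
     (qpoch (a * q ^ 2 * p ^ n) p r * qpoch (a * q * p ^ n) p r) * \<alpha>3 r" for r
  have "bailey_pair a p n \<alpha>4 (\<lambda>m. qpoch c4 p m / (qpoch p p m * qpoch (a * q ^ 2 * p ^ n) p m * qpoch (a * q * p ^ n) p m) *
     (\<Sum>j\<le>m. qpoch (1 / p ^ m) p j * qpoch (q / p ^ n) p j * qpoch (q ^ 2 / p ^ n) p j * p ^ j /
            qpoch (q / p ^ n * (q ^ 2 / p ^ n) / (a * p ^ m)) p j * \<beta>3 j))"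
    unfolding \<alpha>4_def
  proof (rule bailey_lemma_terminating[OF p0 pp a0 _ _ Ap _ _ A2 A1 _ C4 B3])
    show "c4 = a * p / (q / p ^ n * (q ^ 2 / p ^ n))"
      using q0 p0 unfolding c4' by (simp add: p_def power2_eq_square power3_eq_cube mult_2 power_add)
  qed (use q0 p0 in \<open>simp_all add: p_def power2_eq_square power3_eq_cube\<close>)
  then have B4: "qpoch c4 p n / (qpoch p p n * qpoch (a * q ^ 2 * p ^ n) p n * qpoch (a * q * p ^ n) p n) * S =
      (\<Sum>r\<le>n. \<alpha>4 r * qpoch (p ^ n) (1 / p) r / (qpoch p p n * qpoch (a * p) p (n + r)))"
    unfolding S_def bailey_pair_def by simp

  \<comment> \<open>Identification of the chain with the sums of T, V and U\<close>
  have "(\<Sum>m=0..k. T q a x y k m) = (\<Sum>m\<le>k. qpoch (1 / p ^ k) p m * qpoch (x * q ^ 2) p m * qpoch y p m * p ^ m /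
            qpoch (x * q ^ 2 * y / (a * p ^ k)) p m * \<beta>1 m)" for k
    unfolding atMost_atLeast0[symmetric]
  proof (intro sum.cong refl)
    fix m
    have e: "x * y * (q ^ 2 / p ^ k) / a = x * q ^ 2 * y / (a * p ^ k)" by (simp add: mult_ac)
    show "T q a x y k m = qpoch (1 / p ^ k) p m * qpoch (x * q ^ 2) p m * qpoch y p m * p ^ m /
            qpoch (x * q ^ 2 * y / (a * p ^ k)) p m * \<beta>1 m"
      unfolding T_def powi e \<beta>1_def c1_def pn[symmetric] p_def[symmetric] by (simp add: mult_ac)
  qed
  \<comment> \<open>This prefactor supplies the part of V absent from the next Bailey sum; the
    prefactor of \<beta>3 does the same for U.\<close>
  then have TS: "\<beta>2 k = qpoch c2 p k / (qpoch p p k * qpoch (a * q / x) p k * qpoch (a * q ^ 3 / y) p k) *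
      (\<Sum>m=0..k. T q a x y k m)" for k
    by (simp add: \<beta>2_def)
  have VS: "\<beta>3 j = qpoch c3 p j / (qpoch p p j * qpoch (a * q ^ 2 / y) p j * qpoch (a * q / y) p j) *
      (\<Sum>k=0..j. \<Sum>m=0..k. V q a x y j k * T q a x y k m)" for j
    unfolding \<beta>3_def atMost_atLeast0
  proof (intro arg_cong2[where f = "(*)"] sum.cong refl)
    fix k
    have e: "y ^ 2 * (p / p ^ j) / a = y * q * (y * q ^ 2) / (a * p ^ j)"
      by (simp add: p_def power2_eq_square power3_eq_cube mult_ac)
    show "qpoch (1 / p ^ j) p k * qpoch (y * q) p k * qpoch (y * q ^ 2) p k * p ^ k /
            qpoch (y * q * (y * q ^ 2) / (a * p ^ j)) p k * \<beta>2 k = (\<Sum>m=0..k. V q a x y j k * T q a x y k m)"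
      unfolding sum_distrib_left[symmetric] TS V_def powi e c2_def[symmetric] pn[symmetric] p_def[symmetric]
      by (simp add: mult_ac)
  qed
  have US: "S = (\<Sum>j=0..n. \<Sum>k=0..j. \<Sum>m=0..k. U n q a y j * V q a x y j k * T q a x y k m)"
    unfolding S_def atMost_atLeast0
  proof (intro sum.cong refl)
    fix j
    have e: "p / p ^ (3 * n) / a = q / p ^ n * (q ^ 2 / p ^ n) / (a * p ^ n)"
    proof -
      have "p = q * q ^ 2" "p ^ (3 * n) = p ^ n * p ^ n * p ^ n"
        by (simp_all add: p_def power2_eq_square power3_eq_cube power_mult power_mult_distrib)
      then show ?thesis by (simp only: times_divide_eq_left times_divide_eq_right divide_divide_eq_left mult_ac)
    qed
    show "qpoch (1 / p ^ n) p j * qpoch (q / p ^ n) p j * qpoch (q ^ 2 / p ^ n) p j * p ^ j /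
            qpoch (q / p ^ n * (q ^ 2 / p ^ n) / (a * p ^ n)) p j * \<beta>3 j =
          (\<Sum>k=0..j. \<Sum>m=0..k. U n q a y j * V q a x y j k * T q a x y k m)"
    proof -
      have "(\<Sum>k=0..j. \<Sum>m=0..k. U n q a y j * V q a x y j k * T q a x y k m) =
          U n q a y j * (\<Sum>k=0..j. \<Sum>m=0..k. V q a x y j k * T q a x y k m)"
        by (simp add: sum_distrib_left mult.assoc)
      then show ?thesis
        unfolding VS U_def powi e qpoch_triple c3_def[symmetric] pn[symmetric] p_def[symmetric]
        by (simp add: mult_ac)
    qed
  qed

  \<comment> \<open>The single application in base q at index 3n\<close>
  define W where "W = (\<Sum>j\<le>3 * n. qpoch (1 / q ^ (3 * n)) q j * qpoch x q j * qpoch y q j * q ^ j /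
            qpoch (x * y / (a * q ^ (3 * n))) q j * (qpoch a p j / (qpoch q q j * qpoch a q (2 * j))))"
  define \<alpha>' where "\<alpha>' r = qpoch x q r * qpoch y q r * c2 ^ r / (qpoch (a * q / x) q r * qpoch (a * q / y) q r) *
     (if 3 dvd r then cubic_alpha a q (r div 3) else 0)" for r
  have ap: "qpoch a q (2 * (3 * n)) \<noteq> 0" by (rule assms) simp
  have "bailey_pair a q (3 * n) \<alpha>' (\<lambda>m. qpoch c2 q m / (qpoch q q m * qpoch (a * q / x) q m * qpoch (a * q / y) q m) *
     (\<Sum>j\<le>m. qpoch (1 / q ^ m) q j * qpoch x q j * qpoch y q j * q ^ j /
            qpoch (x * y / (a * q ^ m)) q j * (qpoch a (q ^ 3) j / (qpoch q q j * qpoch a q (2 * j)))))"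
    unfolding \<alpha>'_def
    by (rule bailey_lemma_terminating[OF q0 qq a0 x0 y0 Aq refl refl _ _ _ C bailey_pair_cubic[OF q0 qq pp[unfolded p_def] a1 Aq ap]])
       (rule assms | simp add: c2_def)+
  then have "qpoch c2 q (3 * n) / (qpoch q q (3 * n) * qpoch (a * q / x) q (3 * n) * qpoch (a * q / y) q (3 * n)) * W =
     (\<Sum>r\<le>3 * n. \<alpha>' r * qpoch (q ^ (3 * n)) (1 / q) r / (qpoch q q (3 * n) * qpoch (a * q) q (3 * n + r)))"
    unfolding bailey_pair_def W_def p_def by simp
  also have "\<dots> = (\<Sum>r\<le>3 * n. if 3 dvd r then \<alpha>' r * qpoch (q ^ (3 * n)) (1 / q) r / (qpoch q q (3 * n) * qpoch (a * q) q (3 * n + r)) else 0)"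
    by (intro sum.cong refl) (simp add: \<alpha>'_def)
  also have "\<dots> = (\<Sum>r\<le>n. \<alpha>' (3 * r) * qpoch (q ^ (3 * n)) (1 / q) (3 * r) / (qpoch q q (3 * n) * qpoch (a * q) q (3 * n + 3 * r)))"
    by (simp only: sum_multiples_of_3) simp
  finally have BW: "qpoch c2 q (3 * n) / (qpoch q q (3 * n) * qpoch (a * q / x) q (3 * n) * qpoch (a * q / y) q (3 * n)) * W = \<dots>" .

  \<comment> \<open>Termwise comparison of the two single sums\<close>
  have aqn: "qpoch (a * q) q (3 * n) \<noteq> 0" and apn: "qpoch (a * p) p n \<noteq> 0"
    by (rule qpoch_neq0_mono[OF Aq] qpoch_neq0_mono[OF Ap]; simp)+
  \<comment> \<open>The factors of the two kernels independent of r are left out; they are restored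
    as prefactors afterwards.\<close>
  have term_eq: "\<alpha>4 r * qpoch (p ^ n) (1 / p) r / qpoch (a * p * p ^ n) p r =
      \<alpha>' (3 * r) * qpoch (q ^ (3 * n)) (1 / q) (3 * r) / qpoch (a * q * q ^ (3 * n)) q (3 * r)" for r
  proof -
    have r1: "qpoch (q / p ^ n) p r = qsgn p r / (p ^ n / q) ^ r * qpoch (p ^ n / q) (1 / p) r"
      using qpoch_reflect[of p "p ^ n / q" r] p0 q0 by simp
    have r2: "qpoch (q ^ 2 / p ^ n) p r = qsgn p r / (p ^ n / q ^ 2) ^ r * qpoch (p ^ n / q ^ 2) (1 / p) r"
      using qpoch_reflect[of p "p ^ n / q ^ 2" r] p0 q0 by simp
    have fall: "qpoch (q ^ (3 * n)) (1 / q) (3 * r) =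
        qpoch (p ^ n) (1 / p) r * qpoch (p ^ n / q) (1 / p) r * qpoch (p ^ n / q ^ 2) (1 / p) r"
      unfolding qpoch_triple pn[symmetric] by (simp add: power_one_over p_def)
    have tx: "qpoch x q (3 * r) = qpoch x p r * qpoch (x * q) p r * qpoch (x * q ^ 2) p r"
      and ty: "qpoch y q (3 * r) = qpoch y p r * qpoch (y * q) p r * qpoch (y * q ^ 2) p r"
      unfolding qpoch_triple p_def by simp_all
    have tax: "qpoch (a * q / x) q (3 * r) = qpoch (a * q / x) p r * qpoch (a * q ^ 2 / x) p r * qpoch (a * q ^ 3 / x) p r"
      and tay: "qpoch (a * q / y) q (3 * r) = qpoch (a * q / y) p r * qpoch (a * q ^ 2 / y) p r * qpoch (a * q ^ 3 / y) p r"
      unfolding qpoch_triple p_def by (simp_all add: power2_eq_square power3_eq_cube mult_ac)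
    have tan: "qpoch (a * q * q ^ (3 * n)) q (3 * r) =
        qpoch (a * q * p ^ n) p r * qpoch (a * q ^ 2 * p ^ n) p r * qpoch (a * p * p ^ n) p r"
      unfolding qpoch_triple pn[symmetric] by (simp add: p_def power2_eq_square power3_eq_cube mult_ac)
    have ua: "unit_alpha a p r = qsgn p r * (1 - a * q ^ (6 * r)) * qpoch a p r / ((1 - a) * qpoch p p r)"
      by (simp add: unit_alpha_def pn)
    have ca: "cubic_alpha a q r = qsgn p r ^ 3 * p ^ r * a ^ r * (1 - a * q ^ (6 * r)) * qpoch a p r / ((1 - a) * qpoch p p r)"
      by (simp add: cubic_alpha_def qsgn_triple p_def power_mult)
    \<comment> \<open>All r-th powers are gathered here: the four quotients and the reflection
      factors on the base p side, against p, a and the cube of \<open>c2\<close> on the base q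
      side.\<close>
    have "c4 / (p ^ n / q * (p ^ n / q ^ 2)) * c3 * c2 * c1 = p * a * c2 ^ 3"
      unfolding c4' c3_def c2_def c1_def p_def using q0 x0 y0
      by (simp add: power2_eq_square power3_eq_cube mult_2 power_add) (simp add: mult_ac)
    then have "(c4 / (p ^ n / q * (p ^ n / q ^ 2)) * c3 * c2 * c1) ^ r = (p * a * c2 ^ 3) ^ r"
      by simp
    then have pw: "c4 ^ r / ((p ^ n / q) ^ r * (p ^ n / q ^ 2) ^ r) * c3 ^ r * c2 ^ r * c1 ^ r = p ^ r * a ^ r * c2 ^ (3 * r)"
      by (simp only: power_mult_distrib power_divide power_mult)
    define Z where "Z = qsgn p r ^ 3 * qpoch (p ^ n / q) (1 / p) r * qpoch (p ^ n / q ^ 2) (1 / p) r * qpoch (p ^ n) (1 / p) r *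
      (1 - a * q ^ (6 * r)) * qpoch a p r *
      (qpoch x p r * qpoch (x * q) p r * qpoch (x * q ^ 2) p r) * (qpoch y p r * qpoch (y * q) p r * qpoch (y * q ^ 2) p r) /
      ((1 - a) * qpoch p p r * (qpoch (a * q / x) p r * qpoch (a * q ^ 2 / x) p r * qpoch (a * q ^ 3 / x) p r) *
       (qpoch (a * q / y) p r * qpoch (a * q ^ 2 / y) p r * qpoch (a * q ^ 3 / y) p r) *
       (qpoch (a * q * p ^ n) p r * qpoch (a * q ^ 2 * p ^ n) p r * qpoch (a * p * p ^ n) p r))"
    have "\<alpha>4 r * qpoch (p ^ n) (1 / p) r / qpoch (a * p * p ^ n) p r =
        Z * (c4 ^ r / ((p ^ n / q) ^ r * (p ^ n / q ^ 2) ^ r) * c3 ^ r * c2 ^ r * c1 ^ r)"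
      unfolding \<alpha>4_def \<alpha>3_def \<alpha>2_def \<alpha>1_def ua r1 r2 Z_def power3_eq_cube[of "qsgn p r"]
      by (simp only: times_divide_eq_left times_divide_eq_right divide_divide_eq_left divide_divide_eq_right mult_ac)
    moreover have "\<alpha>' (3 * r) * qpoch (q ^ (3 * n)) (1 / q) (3 * r) / qpoch (a * q * q ^ (3 * n)) q (3 * r) =
        Z * (p ^ r * a ^ r * c2 ^ (3 * r))"
    proof -
      have "\<alpha>' (3 * r) = qpoch x q (3 * r) * qpoch y q (3 * r) * c2 ^ (3 * r) /
         (qpoch (a * q / x) q (3 * r) * qpoch (a * q / y) q (3 * r)) * cubic_alpha a q r"
        by (simp add: \<alpha>'_def)
      then show ?thesis
        unfolding ca tx ty tax tay tan fall Z_def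
        by (simp only: times_divide_eq_left times_divide_eq_right divide_divide_eq_left divide_divide_eq_right mult_ac)
    qed
    ultimately show ?thesis by (simp only: pw)
  qed

  \<comment> \<open>Equality of the single sums and extraction of the prefactor\<close>
  have "qpoch p p n * qpoch (a * p) p n * (\<Sum>r\<le>n. \<alpha>4 r * qpoch (p ^ n) (1 / p) r / (qpoch p p n * qpoch (a * p) p (n + r))) =
     (\<Sum>r\<le>n. \<alpha>4 r * qpoch (p ^ n) (1 / p) r / qpoch (a * p * p ^ n) p r)"
    unfolding sum_distrib_left using pp[of n] apn by (intro sum.cong refl) (simp add: qpoch_add)
  also have "\<dots> = (\<Sum>r\<le>n. \<alpha>' (3 * r) * qpoch (q ^ (3 * n)) (1 / q) (3 * r) / qpoch (a * q * q ^ (3 * n)) q (3 * r))"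
    by (simp only: term_eq)
  also have "\<dots> = qpoch q q (3 * n) * qpoch (a * q) q (3 * n) *
     (\<Sum>r\<le>n. \<alpha>' (3 * r) * qpoch (q ^ (3 * n)) (1 / q) (3 * r) / (qpoch q q (3 * n) * qpoch (a * q) q (3 * n + 3 * r)))"
    unfolding sum_distrib_left using qq[of "3 * n"] aqn by (intro sum.cong refl) (simp add: qpoch_add)
  \<comment> \<open>Here (p;p)_n cancels on the left and (q;q)_(3n) on the right; solving for
    \<open>S\<close> gives the stated prefactor.\<close>
  finally have main: "qpoch p p n * qpoch (a * p) p n *
      (qpoch c4 p n / (qpoch p p n * qpoch (a * q ^ 2 * p ^ n) p n * qpoch (a * q * p ^ n) p n) * S) =
      qpoch q q (3 * n) * qpoch (a * q) q (3 * n) *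
      (qpoch c2 q (3 * n) / (qpoch q q (3 * n) * qpoch (a * q / x) q (3 * n) * qpoch (a * q / y) q (3 * n)) * W)"
    unfolding B4 BW .
  have W: "W = (\<Sum>j=0..3 * n.
       (qpoch a (q ^ 3) j * qpoch x q j * qpoch y q j * qpoch (q powi (- 3 * int n)) q j * q ^ j) /
       (qpoch q q j * qpoch a q (2 * j) * qpoch (x * y * q powi (- 3 * int n) / a) q j))"
  proof -
    have e: "x * y * (1 / p ^ n) / a = x * y / (a * p ^ n)" by (simp add: mult_ac)
    show ?thesis
      unfolding W_def powi e pn[symmetric] p_def[symmetric] atMost_atLeast0
      by (intro sum.cong refl) (simp add: mult_ac)
  qed
  have e: "a * q ^ (3 * n + 1) = a * q * p ^ n" "a * q ^ (3 * n + 2) = a * q ^ 2 * p ^ n"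
    by (simp_all add: pn power_add power2_eq_square mult_ac)
  have "qpoch (a * q / x) q (3 * n) \<noteq> 0" "qpoch (a * q / y) q (3 * n) \<noteq> 0" by (rule assms)+
  then show ?thesis
    unfolding US[symmetric] W[symmetric] e unfolding c2_def[symmetric] c4_def[symmetric] p_def[symmetric]
    using main A1 A2 C4 apn pp[of n] qq[of "3 * n"] by (simp add: divide_simps) (simp add: mult_ac)
qed

end
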